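(* Let $\mathbf{m}=\{m_n\}_{n\ge 1}$ be a sequence of integers with $m_n\ge 2$ for every $n\ge 1$, such that only finitely many primes divide the terms of the sequence $\mathbf{m}$ (that is, the set of primes $p$ for which there is $n\ge 1$ with $p\mid m_n$ is finite), and let $T_{\mathbf{m}}$ be the corresponding spherically homogeneous rooted tree. Let $G\le \mathrm{Aut}\,T_{\mathbf{m}}$ be a weakly branch group. Then $G$ contains a continuum (a family of cardinality $2^{\aleph_0}$) of pairwise distinct subgroups, each of which is not closed in the profinite topology on $G$ and is not ERF. In particular $G$ is not ERF.
   Context: For a sequence $\mathbf{m}=\{m_n\}_{n\ge 1}$ of integers $m_n\ge 2$, $T_{\mathbf{m}}$ is the rooted tree in which every vertex at level $n-1$ has exactly $m_n$ immediate descendants, for each $n\ge 1$ (the root is at level $0$). $\mathrm{Aut}\,T_{\mathbf{m}}$ is the group of its (root-preserving) automorphisms. For a vertex $v$, $T_{\mathbf{m}}^v$ is the subtree rooted at $v$. For $G\le \mathrm{Aut}\,T_{\mathbf{m}}$, the rigid stabilizer $\mathrm{rist}_G(v)$ is the subgroup of elements of $G$ acting trivially on $T_{\mathbf{m}}\setminus T_{\mathbf{m}}^v$, and the $n$th rigid level stabilizer $\mathrm{rist}_G(n)\le G$ is the (direct) product of the subgroups $\mathrm{rist}_G(v)$ over all vertices $v$ at level $n$. The group $G$ is weakly branch if it acts transitively on every level of $T_{\mathbf{m}}$ and $\mathrm{rist}_G(n)$ is non-trivial for every $n\ge 1$. The profinite topology on a group $G$ is the group topology in which the finite-index subgroups form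 a basis of open neighbourhoods of the identity. A group is ERF (extended residually finite) if all of its subgroups are closed in its own profinite topology. *)

theory Defs
  imports
    "HOL-Algebra.Bij"
    "HOL-Algebra.Coset"
    "HOL-Algebra.Generated_Groups"
    "HOL-Analysis.Abstract_Topology"
    "HOL-Computational_Algebra.Primes"
    "HOL-Library.Equipollence"
    "HOL-Library.Sublist"
begin

section \<open>Spherically homogeneous rooted trees and their automorphisms\<close>

text \<open>
  A vertex at level \<open>n\<close> is the list of length \<open>n\<close> of the choices made on the way down from the
  root \<open>[]\<close>.  The valency sequence is indexed from 1, so the entry at list position \<open>i\<close> is below
  \<open>m (Suc i)\<close>; the value \<open>m 0\<close> is irrelevant.
\<close>

definition tree_verts :: "(nat \<Rightarrow> nat) \<Rightarrow> nat list set" where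
  "tree_verts m = {v. \<forall>i<length v. v ! i < m (Suc i)}"

definition tree_level :: "(nat \<Rightarrow> nat) \<Rightarrow> nat \<Rightarrow> nat list set" where
  "tree_level m n = {v \<in> tree_verts m. length v = n}"

definition tree_adj :: "nat list \<Rightarrow> nat list \<Rightarrow> bool" where
  "tree_adj u v \<longleftrightarrow> (\<exists>i. v = u @ [i] \<or> u = v @ [i])"

definition subtree :: "(nat \<Rightarrow> nat) \<Rightarrow> nat list \<Rightarrow> nat list set" where
  "subtree m v = {u \<in> tree_verts m. prefix v u}"

definition tree_auts :: "(nat \<Rightarrow> nat) \<Rightarrow> (nat list \<Rightarrow> nat list) set" where
  "tree_auts m = {f \<in> Bij (tree_verts m). f [] = [] \<and>
     (\<forall>u\<in>tree_verts m. \<forall>v\<in>tree_verts m. tree_adj u v \<longleftrightarrow> tree_adj (f u) (f v))}"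

definition aut_tree :: "(nat \<Rightarrow> nat) \<Rightarrow> (nat list \<Rightarrow> nat list) monoid" where
  "aut_tree m = BijGroup (tree_verts m) \<lparr>carrier := tree_auts m\<rparr>"

lemma Nil_in_tree_verts: "[] \<in> tree_verts m"
  by (simp add: tree_verts_def)

lemma carrier_aut_tree: "carrier (aut_tree m) = tree_auts m"
  by (simp add: aut_tree_def)

lemma tree_autsD:
  assumes "f \<in> tree_auts m"
  shows "f \<in> Bij (tree_verts m)" "f [] = []"
    "\<lbrakk>u \<in> tree_verts m; v \<in> tree_verts m\<rbrakk> \<Longrightarrow> tree_adj (f u) (f v) \<longleftrightarrow> tree_adj u v"
  using assms unfolding tree_auts_def by blast+

lemma subgroup_tree_auts: "subgroup (tree_auts m) (BijGroup (tree_verts m))"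
proof (rule group.subgroupI[OF group_BijGroup])
  let ?V = "tree_verts m"
  show "tree_auts m \<subseteq> carrier (BijGroup ?V)"
    by (auto simp: tree_auts_def BijGroup_def)
  have "(\<lambda>x\<in>?V. x) \<in> tree_auts m"
    by (auto simp: tree_auts_def id_Bij Nil_in_tree_verts)
  then show "tree_auts m \<noteq> {}" by blast
  show "inv\<^bsub>BijGroup ?V\<^esub> f \<in> tree_auts m" if f: "f \<in> tree_auts m" for f
  proof -
    have fB: "f \<in> Bij ?V" using f by (rule tree_autsD)
    then have bij: "bij_betw f ?V ?V" by (simp add: Bij_def)
    let ?g = "\<lambda>x\<in>?V. inv_into ?V f x"
    have mem: "inv_into ?V f x \<in> ?V" if "x \<in> ?V" for x
      using fB that by (rule Bij_inv_into_mem)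
    have r: "f (inv_into ?V f x) = x" if "x \<in> ?V" for x
      using bij that by (simp add: bij_betw_inv_into_right)
    have "?g [] = []"
      using bij_betw_inv_into_left[OF bij Nil_in_tree_verts] tree_autsD(2)[OF f] Nil_in_tree_verts[of m]
      by simp
    moreover have "tree_adj u v \<longleftrightarrow> tree_adj (?g u) (?g v)" if "u \<in> ?V" "v \<in> ?V" for u v
    proof -
      have "tree_adj (?g u) (?g v) \<longleftrightarrow> tree_adj (f (?g u)) (f (?g v))"
        using tree_autsD(3)[OF f mem[OF that(1)] mem[OF that(2)]] that by simp
      then show ?thesis using r that by simp
    qed
    ultimately show ?thesis
      using restrict_inv_into_Bij[OF fB] by (simp add: inv_BijGroup[OF fB] tree_auts_def)
  qed
  show "f \<otimes>\<^bsub>BijGroup ?V\<^esub> g \<in> tree_auts m" if f: "f \<in> tree_auts m" and g: "g \<in> tree_auts m" for f g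
  proof -
    have fB: "f \<in> Bij ?V" and gB: "g \<in> Bij ?V" using f g by (auto dest: tree_autsD)
    have mem: "g x \<in> ?V" if "x \<in> ?V" for x
      using Bij_imp_funcset[OF gB] that by auto
    show ?thesis
      using fB gB mem compose_Bij[OF fB gB] tree_autsD(2,3)[OF f] tree_autsD(2,3)[OF g]
      by (simp add: BijGroup_def tree_auts_def compose_def Nil_in_tree_verts)
  qed
qed

lemma group_aut_tree: "group (aut_tree m)"
  unfolding aut_tree_def
  by (rule group.subgroup_imp_group[OF group_BijGroup subgroup_tree_auts])

section \<open>Weakly branch groups\<close>

definition rist :: "(nat \<Rightarrow> nat) \<Rightarrow> (nat list \<Rightarrow> nat list) set \<Rightarrow> nat list \<Rightarrow> (nat list \<Rightarrow> nat list) set" where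
  "rist m G v = {g \<in> G. \<forall>u \<in> tree_verts m - subtree m v. g u = u}"

text \<open>
  Rigid stabilizers of distinct vertices of one level commute (lemma \<open>rist_commute\<close>), so their
  internal product is the subgroup generated by them.
\<close>

definition rist_level :: "(nat \<Rightarrow> nat) \<Rightarrow> (nat list \<Rightarrow> nat list) set \<Rightarrow> nat \<Rightarrow> (nat list \<Rightarrow> nat list) set" where
  "rist_level m G n = generate (aut_tree m) (\<Union>v\<in>tree_level m n. rist m G v)"

definition level_transitive :: "(nat \<Rightarrow> nat) \<Rightarrow> (nat list \<Rightarrow> nat list) set \<Rightarrow> bool" where
  "level_transitive m G \<longleftrightarrow>
     (\<forall>n. \<forall>u\<in>tree_level m n. \<forall>v\<in>tree_level m n. \<exists>g\<in>G. g u = v)"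

definition weakly_branch :: "(nat \<Rightarrow> nat) \<Rightarrow> (nat list \<Rightarrow> nat list) set \<Rightarrow> bool" where
  "weakly_branch m G \<longleftrightarrow> level_transitive m G \<and>
     (\<forall>n\<ge>1. rist_level m G n \<noteq> {\<one>\<^bsub>aut_tree m\<^esub>})"

lemma rist_commute:
  assumes G: "subgroup G (aut_tree m)"
    and uv: "u \<in> tree_level m n" "v \<in> tree_level m n" "u \<noteq> v"
    and g: "g \<in> rist m G u" and h: "h \<in> rist m G v"
  shows "g \<otimes>\<^bsub>aut_tree m\<^esub> h = h \<otimes>\<^bsub>aut_tree m\<^esub> g"
proof -
  let ?V = "tree_verts m"
  have "g \<in> tree_auts m" "h \<in> tree_auts m"
    using G g h subgroup.subset[OF G] by (auto simp: rist_def carrier_aut_tree)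
  then have B: "g \<in> Bij ?V" "h \<in> Bij ?V" by (auto dest: tree_autsD)
  have mem: "k w \<in> ?V" if "k \<in> Bij ?V" "w \<in> ?V" for k w
    using Bij_imp_funcset[OF that(1)] that(2) by auto
  have stay: "prefix x (k w)" if "k \<in> rist m G x" "k \<in> Bij ?V" "w \<in> ?V" "prefix x w" for k x w
  proof (rule ccontr)
    assume np: "\<not> prefix x (k w)"
    then have "k (k w) = k w"
      using that(1) mem[OF that(2,3)] by (simp add: rist_def subtree_def)
    moreover have "inj_on k ?V" using that(2) by (simp add: Bij_def bij_betw_def)
    ultimately have "k w = w"
      using that(3) mem[OF that(2,3)] by (metis inj_onD)
    with np that show False by simp
  qed
  have disj: "\<not> (prefix u w \<and> prefix v w)" for w
    using uv by (auto simp: tree_level_def prefix_def append_eq_append_conv)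
  have fix_g: "g w = w" if "w \<in> ?V" "\<not> prefix u w" for w
    using g that by (auto simp: rist_def subtree_def)
  have fix_h: "h w = w" if "w \<in> ?V" "\<not> prefix v w" for w
    using h that by (auto simp: rist_def subtree_def)
  have "g (h w) = h (g w)" if w: "w \<in> ?V" for w
  proof (cases "prefix u w")
    case True
    then have "h w = w" "h (g w) = g w"
      using fix_h w mem[OF B(1) w] disj stay[OF g B(1) w] by blast+
    then show ?thesis by simp
  next
    case nu: False
    show ?thesis
    proof (cases "prefix v w")
      case True
      then have "g w = w" "g (h w) = h w"
        using fix_g w mem[OF B(2) w] disj stay[OF h B(2) w] by blast+
      then show ?thesis by simp
    next
      case False
      then show ?thesis using nu fix_g fix_h w by simp
    qed
  qed
  then show ?thesis
    using B by (auto simp: aut_tree_def BijGroup_def compose_def)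
qed

section \<open>The profinite topology\<close>

definition finite_index_subgroup :: "'a set \<Rightarrow> ('a, 'b) monoid_scheme \<Rightarrow> bool" where
  "finite_index_subgroup H G \<longleftrightarrow> subgroup H G \<and> finite (rcosets\<^bsub>G\<^esub> H)"

definition profinite_topology :: "('a, 'b) monoid_scheme \<Rightarrow> 'a topology" where
  "profinite_topology G = topology (\<lambda>U. U \<subseteq> carrier G \<and>
     (\<forall>x\<in>U. \<exists>H. finite_index_subgroup H G \<and> x <#\<^bsub>G\<^esub> H \<subseteq> U))"

definition ERF :: "('a, 'b) monoid_scheme \<Rightarrow> bool" where
  "ERF G \<longleftrightarrow> (\<forall>H. subgroup H G \<longrightarrow> closedin (profinite_topology G) H)"

lemma (in group) finite_index_subgroup_Int:
  assumes H: "finite_index_subgroup H G" and K: "finite_index_subgroup K G"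
  shows "finite_index_subgroup (H \<inter> K) G"
proof -
  have sH: "subgroup H G" and sK: "subgroup K G"
    using H K by (auto simp: finite_index_subgroup_def)
  have eq: "(H \<inter> K) #> a = (H #> a) \<inter> (K #> a)" if a: "a \<in> carrier G" for a
  proof
    show "(H \<inter> K) #> a \<subseteq> (H #> a) \<inter> (K #> a)" by (auto simp: r_coset_def)
    show "(H #> a) \<inter> (K #> a) \<subseteq> (H \<inter> K) #> a"
    proof
      fix x assume "x \<in> (H #> a) \<inter> (K #> a)"
      then obtain h k where hk: "h \<in> H" "x = h \<otimes> a" "k \<in> K" "x = k \<otimes> a"
        by (auto simp: r_coset_def)
      then have "h = k"
        using a right_cancel[of a h k] subgroup.mem_carrier[OF sH] subgroup.mem_carrier[OF sK] by metis
      with hk show "x \<in> (H \<inter> K) #> a" by (auto simp: r_coset_def)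
    qed
  qed
  have "rcosets (H \<inter> K) \<subseteq> (\<lambda>(A, B). A \<inter> B) ` ((rcosets H) \<times> (rcosets K))"
  proof
    fix C assume "C \<in> rcosets (H \<inter> K)"
    then obtain a where a: "a \<in> carrier G" "C = (H \<inter> K) #> a" by (auto simp: RCOSETS_def)
    then have "C = (\<lambda>(A, B). A \<inter> B) (H #> a, K #> a)" using eq by simp
    moreover have "(H #> a, K #> a) \<in> (rcosets H) \<times> (rcosets K)"
      using a by (auto simp: RCOSETS_def)
    ultimately show "C \<in> (\<lambda>(A, B). A \<inter> B) ` ((rcosets H) \<times> (rcosets K))" by (rule image_eqI)
  qed
  moreover have "finite ((\<lambda>(A, B). A \<inter> B) ` ((rcosets H) \<times> (rcosets K)))"
    using H K by (simp add: finite_index_subgroup_def)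
  ultimately show ?thesis
    using subgroups_Inter_pair[OF sH sK] finite_subset by (auto simp: finite_index_subgroup_def)
qed

lemma (in group) openin_profinite_topology:
  "openin (profinite_topology G) U \<longleftrightarrow>
     U \<subseteq> carrier G \<and> (\<forall>x\<in>U. \<exists>H. finite_index_subgroup H G \<and> x <# H \<subseteq> U)"
proof -
  define L where "L U \<longleftrightarrow> U \<subseteq> carrier G \<and>
    (\<forall>x\<in>U. \<exists>H. finite_index_subgroup H G \<and> x <# H \<subseteq> U)" for U
  have Int: "L (S \<inter> T)" if S: "L S" and T: "L T" for S T
    unfolding L_def
  proof (intro conjI ballI)
    show "S \<inter> T \<subseteq> carrier G" using S by (auto simp: L_def)
    fix x assume x: "x \<in> S \<inter> T"
    obtain H where H: "finite_index_subgroup H G" "x <# H \<subseteq> S"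
      using S x unfolding L_def by blast
    obtain K where K: "finite_index_subgroup K G" "x <# K \<subseteq> T"
      using T x unfolding L_def by blast
    have "x <# (H \<inter> K) \<subseteq> S \<inter> T" using H(2) K(2) by (auto simp: l_coset_def)
    then show "\<exists>H. finite_index_subgroup H G \<and> x <# H \<subseteq> S \<inter> T"
      using finite_index_subgroup_Int[OF H(1) K(1)] by (intro exI conjI)
  qed
  have Un: "L (\<Union>\<K>)" if \<K>: "\<And>K. K \<in> \<K> \<Longrightarrow> L K" for \<K>
    unfolding L_def
  proof (intro conjI ballI)
    show "\<Union>\<K> \<subseteq> carrier G" using \<K> by (auto simp: L_def)
    fix x assume "x \<in> \<Union>\<K>"
    then obtain K where K: "K \<in> \<K>" "x \<in> K" by blast
    then obtain H where H: "finite_index_subgroup H G" "x <# H \<subseteq> K"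
      using \<K>[OF K(1)] unfolding L_def by blast
    have "x <# H \<subseteq> \<Union>\<K>" using H(2) K(1) by (meson Union_upper order_trans)
    then show "\<exists>H. finite_index_subgroup H G \<and> x <# H \<subseteq> \<Union>\<K>"
      using H(1) by (intro exI conjI)
  qed
  have "istopology L"
    unfolding istopology_def using Int Un by simp
  then have "openin (topology L) U \<longleftrightarrow> L U" by simp
  then show ?thesis by (simp add: profinite_topology_def L_def[abs_def])
qed

lemma (in group) finite_index_subgroup_carrier: "finite_index_subgroup (carrier G) G"
proof -
  have "rcosets (carrier G) \<subseteq> {carrier G}"
    by (auto simp: RCOSETS_def coset_join2 subgroup_self)
  then show ?thesis
    using finite_subset subgroup_self by (auto simp: finite_index_subgroup_def)
qed

lemma (in group) topspace_profinite_topology: "topspace (profinite_topology G) = carrier G"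
proof
  show "topspace (profinite_topology G) \<subseteq> carrier G"
    using openin_profinite_topology openin_topspace by blast
  have "openin (profinite_topology G) (carrier G)"
    using finite_index_subgroup_carrier l_coset_subset_G[of "carrier G"]
    by (auto simp: openin_profinite_topology)
  then show "carrier G \<subseteq> topspace (profinite_topology G)" by (rule openin_subset)
qed

lemma (in group) openin_finite_index_subgroup:
  assumes "finite_index_subgroup H G"
  shows "openin (profinite_topology G) H"
proof -
  have H: "subgroup H G" using assms by (simp add: finite_index_subgroup_def)
  have "x <# H \<subseteq> H" if "x \<in> H" for x
    using that subgroup.m_closed[OF H] by (auto simp: l_coset_def)
  then show ?thesis
    using assms subgroup.subset[OF H] by (auto simp: openin_profinite_topology)
qed

end

theory Submission
  imports Defs "HOL-Algebra.Group_Action" "HOL-Algebra.Sylow" "HOL-Algebra.Multiplicative_Group"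
begin

text \<open>
  Take pairwise incomparable vertices \<open>v\<^sub>0, v\<^sub>1, \<dots>\<close> and elements \<open>x\<^sub>i, y\<^sub>i\<close> of the rigid stabilizer of
  \<open>v\<^sub>i\<close>, and let \<open>z\<^sub>i\<close> be the commutator of \<open>x\<^sub>i\<close> and \<open>y\<^sub>i\<close>.  Elements with different indices commute.
  A finite-index subgroup cannot separate infinitely many \<open>x\<^sub>i\<close>, nor infinitely many \<open>y\<^sub>i\<close>; taking
  commutators of the quotients that it contains, one finds that it contains some \<open>z\<^sub>i\<close>
  (\<open>finite_index_subgroup_contains_commutator\<close>).  Hence a subgroup that contains all
  \<open>z\<^sub>c z\<^sub>i\<inverse>\<close> has every \<open>z\<^sub>c\<close> in its profinite closure.  If one prime \<open>p\<close> divides the orders of all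
  \<open>z\<^sub>i\<close> (infinite orders count as divisible), then mapping each \<open>z\<^sub>i\<close> to \<open>1\<close> is a well-defined map
  from the direct sum of the groups generated by the \<open>z\<^sub>i\<close> onto the integers modulo \<open>p\<close>.  Its kernel
  contains all \<open>z\<^sub>c z\<^sub>i\<inverse>\<close> and no \<open>z\<^sub>c\<close>, so it is not closed.

  The arithmetic hypothesis provides \<open>p\<close>.  The rigid stabilizer of \<open>v\<close> is normalized by the
  stabilizer of \<open>v\<close>, which is transitive on every level below \<open>v\<close>.  So its orbits on such a level
  have a common size dividing a product of terms of \<open>m\<close>, and on a level that it moves this size has
  a prime divisor among the finitely many primes of \<open>m\<close>.  By orbit-stabilizer and Cauchy, that
  prime divides the order of some element (\<open>exists_rist_ord_dvd\<close>).  Such an element \<open>h\<close> is turned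
  into a commutator without losing divisibility by choosing it in the rigid stabilizer of a vertex
  \<open>u\<close> that some \<open>g\<close> moves: \<open>g h g\<inverse>\<close> and \<open>h\<inverse>\<close> have disjoint supports
  (\<open>ord_dvd_ord_commutator\<close>).  With only finitely many primes available, one of them serves infinitely
  many vertices.

  For the family, the kernel construction is applied to an infinite set \<open>J\<close> of indices, while the
  action below the \<open>v\<^sub>i\<close> is left free for the \<open>i\<close> in a disjoint infinite set \<open>I\<close>.  The kernel
  condition on \<open>J\<close> keeps the subgroup from being closed in \<open>G\<close>.  Inside the subgroup, the kernel
  construction for \<open>I\<close> gives a non-closed subgroup, so it is not ERF.  Fixing \<open>J\<close> and varying \<open>I\<close>
  gives a continuum of subgroups (\<open>continuum_of_subgroups\<close>).
\<close>

section \<open>Subgroups that are not closed in the profinite topology\<close>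

lemma (in group) not_closedin_profinite:
  assumes c: "c \<in> carrier G" "c \<notin> K"
    and meets: "\<And>H. finite_index_subgroup H G \<Longrightarrow> \<exists>h\<in>H. c \<otimes> h \<in> K"
  shows "\<not> closedin (profinite_topology G) K"
proof
  assume "closedin (profinite_topology G) K"
  then have "openin (profinite_topology G) (carrier G - K)"
    by (simp add: closedin_def topspace_profinite_topology)
  then obtain H where H: "finite_index_subgroup H G" "c <# H \<subseteq> carrier G - K"
    using c unfolding openin_profinite_topology by blast
  with meets[OF H(1)] show False by (auto simp: l_coset_def)
qed

text \<open>
  Choose distinct \<open>i\<close>, \<open>j\<close>, \<open>k\<close> whose \<open>x\<close>s lie in one coset of \<open>H\<close>, and whose \<open>y\<close>s too.  Then \<open>H\<close> contains \<open>x\<^sub>i x\<^sub>j\<inverse>\<close> and \<open>y\<^sub>i y\<^sub>k\<inverse>\<close>, hence their commutator; as \<open>x\<^sub>j\<close> commutes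
  with \<open>y\<^sub>i\<close> and \<open>y\<^sub>k\<close>, and \<open>x\<^sub>i\<close> with \<open>y\<^sub>k\<close>, this is the commutator of \<open>x\<^sub>i\<close> and \<open>y\<^sub>i\<close> itself.
\<close>

lemma (in group) finite_index_subgroup_contains_commutator:
  assumes H: "finite_index_subgroup H G" and I: "infinite I"
    and xy: "\<And>i. i \<in> I \<Longrightarrow> x i \<in> carrier G" "\<And>i. i \<in> I \<Longrightarrow> y i \<in> carrier G"
    and comm: "\<And>i j. \<lbrakk>i \<in> I; j \<in> I; i \<noteq> j\<rbrakk> \<Longrightarrow> x i \<otimes> y j = y j \<otimes> x i"
  shows "\<exists>i\<in>I. x i \<otimes> y i \<otimes> inv x i \<otimes> inv y i \<in> H"
proof -
  have sH: "subgroup H G" and fin: "finite (rcosets H)"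
    using H by (auto simp: finite_index_subgroup_def)
  define f where "f i = (H #> x i, H #> y i)" for i
  have "f ` I \<subseteq> (rcosets H) \<times> (rcosets H)"
    using xy by (auto simp: f_def RCOSETS_def)
  then have "finite (f ` I)"
    using fin by (meson finite_SigmaI finite_subset)
  then obtain i where i: "i \<in> I" "infinite {a \<in> I. f a = f i}"
    using pigeonhole_infinite[OF I] by blast
  then obtain j where j: "j \<in> I" "f j = f i" "j \<noteq> i"
    using infinite_imp_nonempty[OF Diff_infinite_finite[of "{i}"]] by blast
  obtain k where k: "k \<in> I" "f k = f i" "k \<noteq> i" "k \<noteq> j"
    using infinite_imp_nonempty[OF Diff_infinite_finite[of "{i, j}"]] i(2) by blast
  have quot: "a \<otimes> inv b \<in> H" if "H #> a = H #> b" "a \<in> carrier G" "b \<in> carrier G" for a b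
  proof -
    have "a \<in> H #> b" using that sH by (metis rcos_self)
    then obtain h where h: "h \<in> H" "a = h \<otimes> b" by (auto simp: r_coset_def)
    then have "h \<in> carrier G" using subgroup.mem_carrier[OF sH] by blast
    with h that show ?thesis by (simp add: m_assoc)
  qed
  let ?p = "x i \<otimes> inv x j" and ?q = "y i \<otimes> inv y k"
  have C: "x i \<in> carrier G" "x j \<in> carrier G" "y i \<in> carrier G" "y k \<in> carrier G"
    using xy i j k by auto
  have "?p \<in> H" "?q \<in> H"
    using i j k xy by (auto intro!: quot simp: f_def)
  then have mem: "?p \<otimes> ?q \<otimes> inv ?p \<otimes> inv ?q \<in> H"
    using subgroup.m_closed[OF sH] subgroup.m_inv_closed[OF sH] by metis
  have c1: "inv x j \<otimes> ?q = ?q \<otimes> inv x j"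
  proof -
    have a: "x j \<otimes> y i = y i \<otimes> x j" "x j \<otimes> y k = y k \<otimes> x j"
      using comm i j k by auto
    have "x j \<otimes> inv y k = inv y k \<otimes> x j"
      using a(2) C by (metis inv_closed inv_solve_left' inv_solve_right m_closed m_assoc)
    then have "x j \<otimes> ?q = ?q \<otimes> x j"
      using a(1) C by (metis inv_closed m_assoc)
    then show ?thesis
      using C by (metis inv_closed inv_solve_left' inv_solve_right m_closed m_assoc)
  qed
  have c2: "inv y k \<otimes> inv x i = inv x i \<otimes> inv y k"
    using comm[of i k] i k C by (metis inv_mult_group)
  have cancel: "inv a \<otimes> (a \<otimes> b) = b" if "a \<in> carrier G" "b \<in> carrier G" for a b
    using that by (simp flip: m_assoc)
  have "?p \<otimes> ?q \<otimes> inv ?p \<otimes> inv ?q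
      = x i \<otimes> (inv x j \<otimes> ?q) \<otimes> (x j \<otimes> inv x i) \<otimes> (y k \<otimes> inv y i)"
    using C by (simp add: inv_mult_group m_assoc)
  also have "\<dots> = x i \<otimes> (?q \<otimes> inv x j) \<otimes> (x j \<otimes> inv x i) \<otimes> (y k \<otimes> inv y i)"
    by (simp only: c1)
  also have "\<dots> = x i \<otimes> y i \<otimes> (inv y k \<otimes> inv x i) \<otimes> (y k \<otimes> inv y i)"
    using C by (simp add: m_assoc cancel)
  also have "\<dots> = x i \<otimes> y i \<otimes> inv x i \<otimes> inv y i"
    using C by (simp add: c2 m_assoc cancel)
  finally show ?thesis using mem i(1) by auto
qed

text \<open>\<open>z\<^sub>c\<close> lies in the closure of \<open>K\<close>: modulo a finite-index subgroup it is \<open>z\<^sub>c z\<^sub>i\<inverse>\<close> for some \<open>i\<close>.\<close>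

lemma (in group) not_closedin_profinite_if_commutators_congruent:
  assumes I: "infinite I"
    and xy: "\<And>i. i \<in> I \<Longrightarrow> x i \<in> carrier G" "\<And>i. i \<in> I \<Longrightarrow> y i \<in> carrier G"
    and comm: "\<And>i j. \<lbrakk>i \<in> I; j \<in> I; i \<noteq> j\<rbrakk> \<Longrightarrow> x i \<otimes> y j = y j \<otimes> x i"
    and z: "\<And>i. i \<in> I \<Longrightarrow> z i = x i \<otimes> y i \<otimes> inv x i \<otimes> inv y i"
    and K: "\<And>i j. \<lbrakk>i \<in> I; j \<in> I\<rbrakk> \<Longrightarrow> z i \<otimes> inv z j \<in> K"
    and c: "c \<in> I" "z c \<notin> K"
  shows "\<not> closedin (profinite_topology G) K"
proof (rule not_closedin_profinite[of "z c"])
  show "z c \<in> carrier G" using c xy by (simp add: z)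
  show "z c \<notin> K" by fact
  show "\<exists>h\<in>H. z c \<otimes> h \<in> K" if H: "finite_index_subgroup H G" for H
  proof -
    obtain i where i: "i \<in> I" "z i \<in> H"
      using finite_index_subgroup_contains_commutator[OF H I, of x y] xy comm z by auto
    then have "inv z i \<in> H"
      using H by (simp add: finite_index_subgroup_def subgroup.m_inv_closed)
    then show ?thesis using K[OF c(1) i(1)] by blast
  qed
qed

section \<open>Elements of order divisible by a prime\<close>

lemma (in group) ord_subgroup: "group.ord (G\<lparr>carrier := H\<rparr>) h = ord h" if "subgroup H G"
proof -
  interpret H: group "G\<lparr>carrier := H\<rparr>" using that by (rule subgroup_imp_group)
  show ?thesis unfolding ord_def H.ord_def by (simp flip: nat_pow_consistent)
qed

lemma (in group) exists_ord_eq_prime: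
  assumes "finite (carrier G)" "prime p" "p dvd order G"
  shows "\<exists>g\<in>carrier G. ord g = p"
proof -
  obtain k where "order G = p ^ 1 * k" using assms(3) by auto
  then obtain H where H: "subgroup H G" "card H = p"
    using sylow_thm[OF assms(2) group_axioms] assms(1) by fastforce
  interpret H: group "G\<lparr>carrier := H\<rparr>" using H(1) by (rule subgroup_imp_group)
  have "card H > 1" using H assms(2) by (metis prime_gt_1_nat)
  then have "\<not> H \<subseteq> {\<one>}" using card_mono[of "{\<one>}" H] by auto
  then obtain h where h: "h \<in> H" "h \<noteq> \<one>" by blast
  have hG: "h \<in> carrier G" using h H subgroup.mem_carrier by metis
  have "ord h dvd p"
    using H.ord_dvd_group_order[of h] h H by (simp add: ord_subgroup order_def)
  moreover have "ord h \<noteq> 1" using h hG pow_eq_id[OF hG, of 1] by auto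
  ultimately have "ord h = p" using assms(2) by (auto simp: prime_nat_iff)
  with hG show ?thesis by blast
qed

text \<open>
  The group may be infinite: orbit-stabilizer and Cauchy are applied to its finite image in the
  symmetric group on \<open>E\<close>, and the order of a preimage is a multiple of the order of the image
  (with \<open>0\<close> as the order of an element of infinite order).
\<close>

lemma (in group_action) exists_ord_dvd_if_dvd_card_orbit:
  assumes "finite E" "x \<in> E" "prime p" "p dvd card (orbit G \<phi> x)"
  shows "\<exists>g\<in>carrier G. p dvd group.ord G g"
proof -
  interpret gh: group_hom G "BijGroup E" \<phi> by (rule group_hom)
  let ?Q = "BijGroup E\<lparr>carrier := \<phi> ` carrier G\<rparr>"
  have sub: "subgroup (\<phi> ` carrier G) (BijGroup E)" by (rule gh.img_is_subgroup)
  interpret Q: group ?Q by (rule gh.H.subgroup_imp_group[OF sub])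
  interpret Qa: group_action ?Q E "\<lambda>f. f"
  proof (unfold group_action_def, rule group_hom.intro)
    show "group ?Q" "group (BijGroup E)" by (rule Q.is_group, rule group_BijGroup)
    show "group_hom_axioms ?Q (BijGroup E) (\<lambda>f. f)"
      using subgroup.subset[OF sub] by (auto simp: group_hom_axioms_def hom_def)
  qed
  have "finite (Bij E)"
  proof (rule finite_subset)
    show "Bij E \<subseteq> E \<rightarrow>\<^sub>E E"
      by (auto simp: PiE_def dest: Bij_imp_funcset Bij_imp_extensional)
    show "finite (E \<rightarrow>\<^sub>E E)" using assms(1) by (simp add: finite_PiE)
  qed
  then have fin: "finite (carrier ?Q)"
    using subgroup.subset[OF sub] finite_subset by (auto simp: BijGroup_def)
  have "orbit ?Q (\<lambda>f. f) x = orbit G \<phi> x"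
    by (auto simp: orbit_def)
  then have "p dvd order ?Q"
    using Qa.orbit_stabilizer_theorem[OF assms(2)] assms(4) by (metis dvd_mult2)
  then obtain q where "q \<in> carrier ?Q" "Q.ord q = p"
    using Q.exists_ord_eq_prime[OF fin assms(3)] by blast
  then obtain g where g: "g \<in> carrier G" "gh.H.ord (\<phi> g) = p"
    using gh.H.ord_subgroup[OF sub] by auto
  have "\<phi> g [^]\<^bsub>BijGroup E\<^esub> gh.G.ord g = \<one>\<^bsub>BijGroup E\<^esub>"
    using g(1) by (simp flip: gh.hom_nat_pow)
  then have "p dvd gh.G.ord g"
    using g by (simp add: gh.H.pow_eq_id)
  with g(1) show ?thesis by blast
qed

section \<open>Tree automorphisms and rigid stabilizers\<close>

lemma take_in_tree_verts: "u \<in> tree_verts m \<Longrightarrow> take n u \<in> tree_verts m"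
  by (simp add: tree_verts_def)

lemma append_single_in_tree_verts:
  "u @ [a] \<in> tree_verts m \<longleftrightarrow> u \<in> tree_verts m \<and> a < m (Suc (length u))"
  by (auto simp: tree_verts_def nth_append less_Suc_eq)

text \<open>
  Adjacency alone does not tell parents from children; this is where fixing the root is used.
  An edge below \<open>u\<close> can only go to an edge below \<open>f u\<close>: going up from \<open>f u\<close> leads to the image of
  the parent of \<open>u\<close>, which is already taken.
\<close>

lemma tree_aut_append_single:
  assumes f: "f \<in> tree_auts m" and ua: "u @ [a] \<in> tree_verts m"
  shows "\<exists>b. f (u @ [a]) = f u @ [b]"
  using ua
proof (induction u arbitrary: a rule: rev_induct)
  case Nil
  then have "tree_adj (f []) (f [a])"
    using tree_autsD(3)[OF f Nil_in_tree_verts, of "[a]"] by (simp add: tree_adj_def)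
  then show ?case using tree_autsD(2)[OF f] by (simp add: tree_adj_def)
next
  case (snoc c u)
  have uc: "u @ [c] \<in> tree_verts m" and u: "u \<in> tree_verts m"
    using snoc.prems append_single_in_tree_verts by blast+
  obtain b where b: "f (u @ [c]) = f u @ [b]" using snoc.IH[OF uc] by blast
  have inj: "inj_on f (tree_verts m)"
    using tree_autsD(1)[OF f] by (simp add: Bij_def bij_betw_def)
  have "tree_adj (f (u @ [c])) (f ((u @ [c]) @ [a]))"
    using tree_autsD(3)[OF f uc snoc.prems] by (simp add: tree_adj_def)
  moreover have False if "f (u @ [c]) = f ((u @ [c]) @ [a]) @ [d]" for d
  proof -
    have "f u = f ((u @ [c]) @ [a])" using that b by simp
    then have "u = (u @ [c]) @ [a]" using inj u snoc.prems by (metis inj_onD)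
    then show False by simp
  qed
  ultimately show ?case unfolding tree_adj_def by blast
qed

lemma tree_aut_length_take:
  assumes f: "f \<in> tree_auts m" and u: "u \<in> tree_verts m"
  shows "length (f u) = length u \<and> (\<forall>n. f (take n u) = take n (f u))"
  using u
proof (induction u rule: rev_induct)
  case Nil
  then show ?case using tree_autsD(2)[OF f] by simp
next
  case (snoc a u)
  then have IH: "length (f u) = length u" "\<And>n. f (take n u) = take n (f u)"
    using append_single_in_tree_verts by blast+
  obtain b where b: "f (u @ [a]) = f u @ [b]"
    using tree_aut_append_single[OF f snoc.prems] by blast
  have "f (take n (u @ [a])) = take n (f (u @ [a]))" for n
    using IH b by (cases "n \<le> length u") auto
  then show ?case using IH b by simp
qed

locale tree_group =
  fixes m :: "nat \<Rightarrow> nat" and G :: "(nat list \<Rightarrow> nat list) set"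
  assumes G: "subgroup G (aut_tree m)"
begin

abbreviation V where "V \<equiv> tree_verts m"
abbreviation mult (infixl "\<cdot>" 70) where "f \<cdot> g \<equiv> f \<otimes>\<^bsub>aut_tree m\<^esub> g"
abbreviation inverse where "inverse f \<equiv> inv\<^bsub>aut_tree m\<^esub> f"

end

sublocale tree_group \<subseteq> A: group "aut_tree m"
  by (rule group_aut_tree)

context tree_group
begin

lemma in_auts: "f \<in> carrier (aut_tree m) \<Longrightarrow> f \<in> tree_auts m"
  by (simp add: carrier_aut_tree)

lemma G_carrier: "g \<in> G \<Longrightarrow> g \<in> carrier (aut_tree m)"
  by (rule subgroup.mem_carrier[OF G])

lemma aut_closed: "\<lbrakk>f \<in> carrier (aut_tree m); u \<in> V\<rbrakk> \<Longrightarrow> f u \<in> V"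
  using tree_autsD(1)[OF in_auts] Bij_imp_funcset by blast

lemma aut_inj: "\<lbrakk>f \<in> carrier (aut_tree m); u \<in> V; w \<in> V; f u = f w\<rbrakk> \<Longrightarrow> u = w"
  using tree_autsD(1)[OF in_auts] unfolding Bij_def bij_betw_def by (blast dest: inj_onD)

lemma aut_length: "\<lbrakk>f \<in> carrier (aut_tree m); u \<in> V\<rbrakk> \<Longrightarrow> length (f u) = length u"
  using tree_aut_length_take[OF in_auts] by blast

lemma aut_prefix:
  "\<lbrakk>f \<in> carrier (aut_tree m); w \<in> V; prefix u w\<rbrakk> \<Longrightarrow> prefix (f u) (f w)"
  using tree_aut_length_take[OF in_auts, of f w]
  by (metis append_eq_conv_conj prefix_def take_is_prefix)

lemma mult_apply:
  "\<lbrakk>f \<in> carrier (aut_tree m); g \<in> carrier (aut_tree m); u \<in> V\<rbrakk> \<Longrightarrow> (f \<cdot> g) u = f (g u)"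
  using tree_autsD(1)[OF in_auts, of f] tree_autsD(1)[OF in_auts, of g]
  by (simp add: aut_tree_def BijGroup_def compose_def)

lemma one_apply: "u \<in> V \<Longrightarrow> \<one>\<^bsub>aut_tree m\<^esub> u = u"
  by (simp add: aut_tree_def BijGroup_def)

lemma inverse_apply_eq_iff:
  assumes "f \<in> carrier (aut_tree m)" "u \<in> V" "w \<in> V"
  shows "inverse f u = w \<longleftrightarrow> u = f w"
  using assms by (metis A.inv_closed A.l_inv A.r_inv mult_apply one_apply)

lemma aut_eqI:
  assumes "f \<in> carrier (aut_tree m)" "g \<in> carrier (aut_tree m)" "\<And>u. u \<in> V \<Longrightarrow> f u = g u"
  shows "f = g"
  using tree_autsD(1)[OF in_auts[OF assms(1)]] tree_autsD(1)[OF in_auts[OF assms(2)]] assms(3)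
  by (auto intro: extensionalityI dest: Bij_imp_extensional)

lemma rist_carrier: "g \<in> rist m G v \<Longrightarrow> g \<in> carrier (aut_tree m)"
  by (simp add: rist_def G_carrier)

lemma rist_fix: "\<lbrakk>g \<in> rist m G v; u \<in> V; \<not> prefix v u\<rbrakk> \<Longrightarrow> g u = u"
  by (simp add: rist_def subtree_def)

lemma rist_subgroup: "subgroup (rist m G v) (aut_tree m)"
proof (rule A.subgroupI)
  show "rist m G v \<subseteq> carrier (aut_tree m)" using rist_carrier by blast
  have "\<one>\<^bsub>aut_tree m\<^esub> \<in> rist m G v"
    using subgroup.one_closed[OF G] by (simp add: rist_def one_apply)
  then show "rist m G v \<noteq> {}" by blast
  show "inverse g \<in> rist m G v" if "g \<in> rist m G v" for g
    using that rist_carrier[OF that] subgroup.m_inv_closed[OF G]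
    by (auto simp: rist_def inverse_apply_eq_iff)
  show "g \<cdot> h \<in> rist m G v" if "g \<in> rist m G v" "h \<in> rist m G v" for g h
    using that rist_carrier[OF that(1)] rist_carrier[OF that(2)] subgroup.m_closed[OF G]
    by (auto simp: rist_def mult_apply)
qed

lemma rist_mono: "prefix v w \<Longrightarrow> rist m G w \<subseteq> rist m G v"
  by (auto simp: rist_def subtree_def dest: prefix_order.order_trans)

lemma rist_stays:
  assumes g: "g \<in> rist m G v" and w: "w \<in> V" "prefix v w"
  shows "prefix v (g w)"
proof (rule ccontr)
  assume "\<not> prefix v (g w)"
  then have "g (g w) = g w"
    using rist_fix[OF g] aut_closed[OF rist_carrier[OF g] w(1)] by blast
  then have "g w = w"
    using aut_inj[OF rist_carrier[OF g]] aut_closed[OF rist_carrier[OF g]] w(1) by blast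
  with \<open>\<not> prefix v (g w)\<close> w(2) show False by simp
qed

lemma rist_eqI:
  assumes "g \<in> rist m G v" "h \<in> rist m G v" "\<And>u. u \<in> subtree m v \<Longrightarrow> g u = h u"
  shows "g = h"
proof (rule aut_eqI)
  show "g u = h u" if "u \<in> V" for u
    using assms that by (cases "prefix v u") (auto simp: rist_fix subtree_def)
qed (use assms rist_carrier in auto)

lemma rist_conj:
  assumes g: "g \<in> rist m G v" and h: "h \<in> G" and v: "v \<in> V"
  shows "h \<cdot> g \<cdot> inverse h \<in> rist m G (h v)"
proof -
  have C: "h \<in> carrier (aut_tree m)" "g \<in> carrier (aut_tree m)"
    using h g by (auto simp: G_carrier rist_carrier)
  have "(h \<cdot> g \<cdot> inverse h) u = u" if u: "u \<in> V" "\<not> prefix (h v) u" for u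
  proof -
    define w where "w = inverse h u"
    have w: "w \<in> V" "h w = u"
      using C u aut_closed[of "inverse h" u] inverse_apply_eq_iff[of h u w] by (auto simp: w_def)
    then have "\<not> prefix v w" using u aut_prefix[OF C(1) w(1)] by auto
    then have "g w = w" using rist_fix[OF g] w by blast
    then show ?thesis using C u w by (simp add: mult_apply aut_closed flip: w_def)
  qed
  moreover have "h \<cdot> g \<cdot> inverse h \<in> G"
    using G g h by (simp add: rist_def subgroup.m_closed subgroup.m_inv_closed)
  ultimately show ?thesis by (simp add: rist_def subtree_def)
qed

text \<open>
  Truncating both vertices to the shorter length gives distinct vertices of one level, whose rigid
  stabilizers are larger.
\<close>

lemma rist_commute_incomparable:
  assumes uv: "u \<in> V" "v \<in> V" "\<not> prefix u v" "\<not> prefix v u"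
    and g: "g \<in> rist m G u" and h: "h \<in> rist m G v"
  shows "g \<cdot> h = h \<cdot> g"
proof -
  let ?n = "min (length u) (length v)"
  have "take ?n u \<noteq> take ?n v"
    using uv(3,4) by (metis min_def order_refl take_all take_is_prefix)
  moreover have "take ?n u \<in> tree_level m ?n" "take ?n v \<in> tree_level m ?n"
    using uv by (auto simp: tree_level_def take_in_tree_verts)
  moreover have "g \<in> rist m G (take ?n u)" "h \<in> rist m G (take ?n v)"
    using g h rist_mono[OF take_is_prefix] by blast+
  ultimately show ?thesis using rist_commute[OF G] by blast
qed

lemma rist_Int_incomparable:
  assumes "\<not> prefix u v" "\<not> prefix v u" "g \<in> rist m G u" "g \<in> rist m G v"
  shows "g = \<one>\<^bsub>aut_tree m\<^esub>"
proof (rule aut_eqI)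
  show "g w = \<one>\<^bsub>aut_tree m\<^esub> w" if "w \<in> V" for w
    using assms that prefix_same_cases[of u w v] by (metis one_apply rist_fix)
qed (use assms rist_carrier in auto)

text \<open>
  The commutator is the product of \<open>g h g\<inverse>\<close> and \<open>h\<inverse>\<close>, which live on the disjoint subtrees below
  \<open>g u\<close> and \<open>u\<close>; so it is trivial to a power only if \<open>h\<close> is.
\<close>

lemma ord_dvd_ord_commutator:
  assumes u: "u \<in> V" and g: "g \<in> G" "g u \<noteq> u" and h: "h \<in> rist m G u"
  shows "A.ord h dvd A.ord (g \<cdot> h \<cdot> inverse g \<cdot> inverse h)"
proof -
  have C: "g \<in> carrier (aut_tree m)" "h \<in> carrier (aut_tree m)"
    using g h by (auto simp: G_carrier rist_carrier)
  define h' where "h' = g \<cdot> h \<cdot> inverse g"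
  have h': "h' \<in> rist m G (g u)" "h' \<in> carrier (aut_tree m)"
    using rist_conj[OF h g(1) u] C by (auto simp: h'_def)
  have gu: "g u \<in> V" "length (g u) = length u"
    using C u by (auto simp: aut_closed aut_length)
  then have inc: "\<not> prefix (g u) u" "\<not> prefix u (g u)"
    using not_equal_is_parallel[OF g(2) gu(2)] by blast+
  define z where "z = h' \<cdot> inverse h"
  have invh: "inverse h \<in> rist m G u"
    using h subgroup.m_inv_closed[OF rist_subgroup] by blast
  have "h [^]\<^bsub>aut_tree m\<^esub> A.ord z = \<one>\<^bsub>aut_tree m\<^esub>"
  proof -
    let ?n = "A.ord z"
    have "z [^]\<^bsub>aut_tree m\<^esub> ?n = \<one>\<^bsub>aut_tree m\<^esub>"
      using h' C by (simp add: z_def)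
    moreover have "z [^]\<^bsub>aut_tree m\<^esub> ?n
        = h' [^]\<^bsub>aut_tree m\<^esub> ?n \<cdot> inverse h [^]\<^bsub>aut_tree m\<^esub> ?n"
      using A.pow_mult_distrib[OF rist_commute_incomparable[OF gu(1) u inc h'(1) invh]] h' C
      by (simp add: z_def)
    ultimately have "h' [^]\<^bsub>aut_tree m\<^esub> ?n = h [^]\<^bsub>aut_tree m\<^esub> ?n"
      using h' C by (metis A.inv_equality A.inv_inv A.nat_pow_closed A.nat_pow_inv A.inv_closed)
    moreover have "h' [^]\<^bsub>aut_tree m\<^esub> ?n \<in> rist m G (g u)" "h [^]\<^bsub>aut_tree m\<^esub> ?n \<in> rist m G u"
      using A.subgroup_int_pow_closed[OF rist_subgroup h'(1), of "int ?n"]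
        A.subgroup_int_pow_closed[OF rist_subgroup h, of "int ?n"] by (simp_all add: int_pow_int)
    ultimately show ?thesis using rist_Int_incomparable[OF inc] by metis
  qed
  then show ?thesis using C by (simp add: A.pow_eq_id z_def h'_def)
qed

end

section \<open>A prime dividing orders in every rigid stabilizer\<close>

definition subtree_level :: "(nat \<Rightarrow> nat) \<Rightarrow> nat list \<Rightarrow> nat \<Rightarrow> nat list set" where
  "subtree_level m v k = {u \<in> subtree m v. length u = k}"

text \<open>The cardinality is the product of the \<open>m n\<close> with \<open>length v < n \<le> k\<close>.\<close>

lemma finite_subtree_level_and_prime_dvd_card:
  assumes v: "v \<in> tree_verts m" and k: "length v \<le> k"
  shows "finite (subtree_level m v k) \<and>
    (\<forall>p. prime p \<longrightarrow> p dvd card (subtree_level m v k) \<longrightarrow> (\<exists>n\<ge>1. p dvd m n))"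
  using k
proof (induction k rule: dec_induct)
  case base
  have "subtree_level m v (length v) = {v}"
    using v by (auto simp: subtree_level_def subtree_def prefix_def)
  then show ?case by (auto simp: prime_nat_iff)
next
  case (step k)
  let ?f = "\<lambda>(u, a). u @ [a]"
  have eq: "subtree_level m v (Suc k) = ?f ` (subtree_level m v k \<times> {..<m (Suc k)})"
  proof (intro equalityI subsetI)
    fix w assume w: "w \<in> subtree_level m v (Suc k)"
    then obtain u a where ua: "w = u @ [a]"
      by (cases w rule: rev_cases) (auto simp: subtree_level_def)
    with w step.hyps have "u \<in> subtree_level m v k" "a < m (Suc k)"
      by (auto simp: subtree_level_def subtree_def append_single_in_tree_verts)
    with ua show "w \<in> ?f ` (subtree_level m v k \<times> {..<m (Suc k)})" by auto
  next
    fix w assume "w \<in> ?f ` (subtree_level m v k \<times> {..<m (Suc k)})"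
    then show "w \<in> subtree_level m v (Suc k)"
      by (auto simp: subtree_level_def subtree_def append_single_in_tree_verts)
  qed
  have "inj_on ?f (subtree_level m v k \<times> {..<m (Suc k)})" by (auto simp: inj_on_def)
  then have card: "card (subtree_level m v (Suc k)) = card (subtree_level m v k) * m (Suc k)"
    by (simp add: eq card_image card_cartesian_product)
  show ?case
  proof (intro conjI allI impI)
    show "finite (subtree_level m v (Suc k))" using step.IH by (simp add: eq)
    show "\<exists>n\<ge>1. p dvd m n"
      if "prime p" "p dvd card (subtree_level m v (Suc k))" for p
    proof (cases "p dvd m (Suc k)")
      case True
      then show ?thesis by (intro exI[of _ "Suc k"]) simp
    next
      case False
      then have "p dvd card (subtree_level m v k)"
        using that card by (simp add: prime_dvd_mult_iff)
      then show ?thesis using step.IH that(1) by blast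
    qed
  qed
qed

context tree_group
begin

lemma rist_acts_on_subtree_level:
  assumes v: "v \<in> V" and k: "length v \<le> k"
  shows "group_action (aut_tree m\<lparr>carrier := rist m G v\<rparr>) (subtree_level m v k)
           (\<lambda>g. restrict g (subtree_level m v k))"
proof -
  let ?E = "subtree_level m v k"
  have EV: "?E \<subseteq> V" by (auto simp: subtree_level_def subtree_def)
  have maps: "g ` ?E \<subseteq> ?E" if "g \<in> rist m G v" for g
    using that rist_carrier[OF that]
    by (auto simp: subtree_level_def subtree_def aut_closed aut_length rist_stays)
  have inj: "inj_on g ?E" if "g \<in> rist m G v" for g
    using aut_inj[OF rist_carrier[OF that]] EV by (meson inj_onI subsetD)
  have fin: "finite ?E" using finite_subtree_level_and_prime_dvd_card[OF v k] by blast
  have bij: "restrict g ?E \<in> Bij ?E" if "g \<in> rist m G v" for g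
    using endo_inj_surj[OF fin maps[OF that] inj[OF that]] inj[OF that]
    by (simp add: Bij_def bij_betw_def)
  show ?thesis
    unfolding group_action_def
  proof (rule group_hom.intro)
    show "group (aut_tree m\<lparr>carrier := rist m G v\<rparr>)"
      by (rule A.subgroup_imp_group[OF rist_subgroup])
    show "group (BijGroup ?E)" by (rule group_BijGroup)
    have "restrict (g \<cdot> h) ?E = compose ?E (restrict g ?E) (restrict h ?E)"
      if "g \<in> rist m G v" "h \<in> rist m G v" for g h
    proof
      fix u show "restrict (g \<cdot> h) ?E u = compose ?E (restrict g ?E) (restrict h ?E) u"
        using that maps[OF that(2)] EV rist_carrier
        by (auto simp: compose_def mult_apply subset_iff image_subset_iff)
    qed
    then show "group_hom_axioms (aut_tree m\<lparr>carrier := rist m G v\<rparr>) (BijGroup ?E)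
       (\<lambda>g. restrict g ?E)"
      using bij by (auto simp: group_hom_axioms_def hom_def BijGroup_def)
  qed
qed

text \<open>
  The stabilizer of \<open>v\<close> in \<open>G\<close> normalizes \<open>rist m G v\<close> and permutes each level of the subtree below
  \<open>v\<close> transitively.  So the orbits of \<open>rist m G v\<close> on such a level have a common size, which
  divides a product of terms of \<open>m\<close>, and which is not \<open>1\<close> on a level that is moved.
\<close>

lemma exists_rist_ord_dvd:
  assumes trans: "level_transitive m G" and v: "v \<in> V"
    and nontriv: "rist m G v \<noteq> {\<one>\<^bsub>aut_tree m\<^esub>}"
  shows "\<exists>p. prime p \<and> (\<exists>n\<ge>1. p dvd m n) \<and> (\<exists>h\<in>rist m G v. p dvd A.ord h)"
proof -
  let ?R = "rist m G v"
  have "\<one>\<^bsub>aut_tree m\<^esub> \<in> ?R" by (rule subgroup.one_closed[OF rist_subgroup])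
  then obtain g where g: "g \<in> ?R" "g \<noteq> \<one>\<^bsub>aut_tree m\<^esub>" using nontriv by blast
  then obtain u where u: "u \<in> V" "g u \<noteq> u"
    using aut_eqI[OF rist_carrier[OF g(1)] A.one_closed] by (auto simp: one_apply)
  then have pu: "prefix v u" using rist_fix[OF g(1)] by blast
  define k where "k = length u"
  define E where "E = subtree_level m v k"
  define \<phi> where "\<phi> = (\<lambda>g::nat list \<Rightarrow> nat list. restrict g E)"
  let ?N = "aut_tree m\<lparr>carrier := ?R\<rparr>"
  have k: "length v \<le> k" using pu by (simp add: k_def prefix_length_le)
  interpret group_action ?N E \<phi>
    unfolding E_def \<phi>_def by (rule rist_acts_on_subtree_level[OF v k])
  have fin: "finite E"
    and prime_dvd: "\<And>p. \<lbrakk>prime p; p dvd card E\<rbrakk> \<Longrightarrow> \<exists>n\<ge>1. p dvd m n"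
    using finite_subtree_level_and_prime_dvd_card[OF v k] by (auto simp: E_def)
  have uE: "u \<in> E" using u pu by (simp add: E_def subtree_level_def subtree_def k_def)
  have orb: "orbit ?N \<phi> w = (\<lambda>h. h w) ` ?R" if "w \<in> E" for w
    using that by (auto simp: orbit_def \<phi>_def)
  have orbE: "orbit ?N \<phi> w \<subseteq> E" if "w \<in> E" for w
    using that element_image by (auto simp: orbit_def)
  have le: "card (orbit ?N \<phi> w) \<le> card (orbit ?N \<phi> w')" if w: "w \<in> E" "w' \<in> E" for w w'
  proof -
    have VE: "w \<in> V" "w' \<in> V" "length w = k" "length w' = k" "prefix v w" "prefix v w'"
      using w by (auto simp: E_def subtree_level_def subtree_def)
    obtain h where h: "h \<in> G" "h w = w'"
      using trans VE by (auto simp: level_transitive_def tree_level_def)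
    have hC: "h \<in> carrier (aut_tree m)" using h(1) by (rule G_carrier)
    have "prefix (h v) w'" using aut_prefix[OF hC VE(1,5)] h(2) by simp
    then have hv: "h v = v"
      using VE(6) aut_length[OF hC v] not_equal_is_parallel[of "h v" v]
      by (metis parallel_def prefix_same_cases)
    \<comment> \<open>Conjugation by \<open>h\<close> preserves the rigid stabilizer, so \<open>h\<close> maps orbits into orbits.\<close>
    have "h ` orbit ?N \<phi> w \<subseteq> orbit ?N \<phi> w'"
    proof (clarsimp simp: orb[OF w(1)] orb[OF w(2)])
      fix n assume n: "n \<in> ?R"
      have "(h \<cdot> n \<cdot> inverse h) w' = h (n w)"
        using hC rist_carrier[OF n] VE h(2)
        by (metis A.inv_closed A.m_closed aut_closed inverse_apply_eq_iff mult_apply)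
      then show "h (n w) \<in> (\<lambda>h. h w') ` ?R"
        using rist_conj[OF n h(1) v] hv by (metis image_eqI)
    qed
    moreover have "inj_on h (orbit ?N \<phi> w)"
    proof (rule inj_on_subset)
      show "inj_on h V" using aut_inj[OF hC] by (meson inj_onI)
      show "orbit ?N \<phi> w \<subseteq> V"
        using orbE[OF w(1)] by (auto simp: E_def subtree_level_def subtree_def)
    qed
    moreover have "finite (orbit ?N \<phi> w')" using orbE[OF w(2)] fin finite_subset by blast
    ultimately show ?thesis by (meson card_inj_on_le)
  qed
  define s where "s = card (orbit ?N \<phi> u)"
  have "s * card (orbits ?N E \<phi>) = card (\<Union>(orbits ?N E \<phi>))"
  proof (rule card_partition)
    show "finite (orbits ?N E \<phi>)" using fin by (simp add: orbits_def)
    show "finite (\<Union>(orbits ?N E \<phi>))" by (simp add: orbits_coverture fin)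
    show "card c = s" if "c \<in> orbits ?N E \<phi>" for c
      using that le uE by (auto simp: orbits_def s_def intro: antisym)
    show "c1 \<inter> c2 = {}" if "c1 \<in> orbits ?N E \<phi>" "c2 \<in> orbits ?N E \<phi>" "c1 \<noteq> c2" for c1 c2
      using disjoint_union that by blast
  qed
  then have "s dvd card E" by (metis dvd_triv_left orbits_coverture)
  have "s \<noteq> 1"
  proof
    assume "s = 1"
    then obtain w where "orbit ?N \<phi> u = {w}" by (auto simp: s_def card_1_singleton_iff)
    moreover have "u \<in> orbit ?N \<phi> u" using uE by (rule orbit_refl)
    moreover have "g u \<in> orbit ?N \<phi> u" using orb[OF uE] g(1) by blast
    ultimately show False using u(2) by simp
  qed
  then obtain p where p: "prime p" "p dvd s" using prime_factor_nat by blast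
  obtain h where "h \<in> ?R" "p dvd group.ord ?N h"
    using exists_ord_dvd_if_dvd_card_orbit[OF fin uE p(1)] p(2) by (auto simp: s_def)
  then have "h \<in> ?R" "p dvd A.ord h" by (simp_all add: A.ord_subgroup[OF rist_subgroup])
  moreover have "\<exists>n\<ge>1. p dvd m n"
    using prime_dvd[OF p(1)] p(2) \<open>s dvd card E\<close> dvd_trans by blast
  ultimately show ?thesis using p(1) by blast
qed

text \<open>
  By transitivity the rigid stabilizers of one level are conjugate, so if one is trivial, all are.
\<close>

lemma rist_nontrivial:
  assumes wb: "weakly_branch m G" and v: "v \<in> V" "v \<noteq> []"
  shows "rist m G v \<noteq> {\<one>\<^bsub>aut_tree m\<^esub>}"
proof
  assume triv: "rist m G v = {\<one>\<^bsub>aut_tree m\<^esub>}"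
  let ?n = "length v"
  have "rist m G w \<subseteq> {\<one>\<^bsub>aut_tree m\<^esub>}" if w: "w \<in> tree_level m ?n" for w
  proof
    fix g assume g: "g \<in> rist m G w"
    have "v \<in> tree_level m ?n" using v(1) by (simp add: tree_level_def)
    then obtain h where h: "h \<in> G" "h w = v"
      using wb w unfolding weakly_branch_def level_transitive_def by blast
    have "h \<cdot> g \<cdot> inverse h = \<one>\<^bsub>aut_tree m\<^esub>"
      using rist_conj[OF g h(1)] w h(2) triv by (auto simp: tree_level_def)
    moreover have "h \<cdot> g = (h \<cdot> g \<cdot> inverse h) \<cdot> h"
      using G_carrier[OF h(1)] rist_carrier[OF g] by (simp add: A.m_assoc)
    ultimately have "h \<cdot> g = h \<cdot> \<one>\<^bsub>aut_tree m\<^esub>"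
      using G_carrier[OF h(1)] by simp
    then have "g = \<one>\<^bsub>aut_tree m\<^esub>"
      using A.Units_l_cancel[of h g "\<one>\<^bsub>aut_tree m\<^esub>"] G_carrier[OF h(1)] rist_carrier[OF g] by simp
    then show "g \<in> {\<one>\<^bsub>aut_tree m\<^esub>}" by simp
  qed
  then have "(\<Union>w\<in>tree_level m ?n. rist m G w) \<subseteq> {\<one>\<^bsub>aut_tree m\<^esub>}" by blast
  then have "rist_level m G ?n \<subseteq> {\<one>\<^bsub>aut_tree m\<^esub>}"
    unfolding rist_level_def using A.generate_subgroup_incl[OF _ A.triv_subgroup] by blast
  moreover have "\<one>\<^bsub>aut_tree m\<^esub> \<in> rist_level m G ?n"
    unfolding rist_level_def by (rule generate.one)
  moreover have "?n \<ge> 1" using v(2) by (simp add: Suc_le_eq)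
  ultimately show False using wb by (auto simp: weakly_branch_def)
qed

text \<open>
  A nontrivial \<open>g\<close> in the rigid stabilizer moves some vertex \<open>u\<close> below \<open>v\<close>; the partner of \<open>g\<close> in
  the commutator is sought in the smaller rigid stabilizer of \<open>u\<close>.
\<close>

lemma exists_commutator_in_rist_ord_dvd:
  assumes wb: "weakly_branch m G" and v: "v \<in> V" "v \<noteq> []"
  shows "\<exists>p. prime p \<and> (\<exists>n\<ge>1. p dvd m n) \<and>
    (\<exists>x\<in>rist m G v. \<exists>y\<in>rist m G v. p dvd A.ord (x \<cdot> y \<cdot> inverse x \<cdot> inverse y))"
proof -
  have "\<one>\<^bsub>aut_tree m\<^esub> \<in> rist m G v" by (rule subgroup.one_closed[OF rist_subgroup])
  then obtain g where g: "g \<in> rist m G v" "g \<noteq> \<one>\<^bsub>aut_tree m\<^esub>"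
    using rist_nontrivial[OF wb v] by blast
  then obtain u where u: "u \<in> V" "g u \<noteq> u"
    using aut_eqI[OF rist_carrier[OF g(1)] A.one_closed] by (auto simp: one_apply)
  then have pu: "prefix v u" using rist_fix[OF g(1)] by blast
  then have "u \<noteq> []" using v(2) by auto
  then obtain p h where p: "prime p" "\<exists>n\<ge>1. p dvd m n" and h: "h \<in> rist m G u" "p dvd A.ord h"
    using exists_rist_ord_dvd[OF _ u(1) rist_nontrivial[OF wb u(1)]] wb
    by (auto simp: weakly_branch_def)
  have "p dvd A.ord (g \<cdot> h \<cdot> inverse g \<cdot> inverse h)"
    using ord_dvd_ord_commutator[of u g h] u g(1) h dvd_trans by (auto simp: rist_def)
  moreover have "h \<in> rist m G v" using h(1) rist_mono[OF pu] by (rule subsetD[rotated])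
  ultimately have "\<exists>y\<in>rist m G v. p dvd A.ord (g \<cdot> y \<cdot> inverse g \<cdot> inverse y)"
    by (rule bexI)
  then have "\<exists>x\<in>rist m G v. \<exists>y\<in>rist m G v. p dvd A.ord (x \<cdot> y \<cdot> inverse x \<cdot> inverse y)"
    using g(1) by (rule bexI)
  then show ?thesis using p by (intro exI[of _ p]) simp
qed

text \<open>
  The vertices branching off the leftmost ray are pairwise incomparable, and only finitely many
  primes occur for them, so one prime occurs infinitely often.
\<close>

lemma exists_incomparable_commutators_ord_dvd:
  assumes m: "\<forall>n\<ge>1. m n \<ge> 2" and fin: "finite {p. prime p \<and> (\<exists>n\<ge>1. p dvd m n)}"
    and wb: "weakly_branch m G"
  shows "\<exists>p (v :: nat \<Rightarrow> nat list) x y. prime p \<and>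
    (\<forall>i j. i \<noteq> j \<longrightarrow> \<not> prefix (v i) (v j)) \<and>
    (\<forall>i. v i \<in> V \<and> x i \<in> rist m G (v i) \<and> y i \<in> rist m G (v i) \<and>
      p dvd A.ord (x i \<cdot> y i \<cdot> inverse (x i) \<cdot> inverse (y i)))"
proof -
  define w :: "nat \<Rightarrow> nat list" where "w i = replicate i 0 @ [1]" for i
  have inc: "\<not> prefix (w i) (w j)" if "i \<noteq> j" for i j
  proof
    assume "prefix (w i) (w j)"
    then obtain zs where zs: "w j = w i @ zs" by (auto simp: prefix_def)
    have "length (w i) \<le> length (w j)" by (simp add: zs)
    then have "i < j" using that by (simp add: w_def)
    then have "w j ! i = 0" by (simp add: w_def nth_append)
    moreover have "w j ! i = 1" using zs by (simp add: w_def nth_append)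
    ultimately show False by simp
  qed
  have wV: "w i \<in> V" for i
  proof -
    have "replicate i 0 ! k < m (Suc k)" if "k < i" for k
      using m[rule_format, of "Suc k"] that by simp
    moreover have "1 < m (Suc i)" using m[rule_format, of "Suc i"] by simp
    ultimately show ?thesis by (simp add: w_def tree_verts_def nth_append less_Suc_eq)
  qed
  have wne: "w i \<noteq> []" for i by (simp add: w_def)
  define Q where "Q p i \<longleftrightarrow> (\<exists>x\<in>rist m G (w i). \<exists>y\<in>rist m G (w i).
    p dvd A.ord (x \<cdot> y \<cdot> inverse x \<cdot> inverse y))" for p i
  have "\<forall>i\<in>UNIV. \<exists>p\<in>{p. prime p \<and> (\<exists>n\<ge>1. p dvd m n)}. Q p i"
    using exists_commutator_in_rist_ord_dvd[OF wb wV wne] by (simp add: Q_def Bex_def conj_assoc)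
  then obtain p where p: "prime p" "infinite {i. Q p i}"
    using pigeonhole_infinite_rel[OF infinite_UNIV_nat fin, of "\<lambda>i p. Q p i"] by auto
  then obtain r :: "nat \<Rightarrow> nat" where r: "strict_mono r" "\<And>i. Q p (r i)"
    using infinite_enumerate by blast
  obtain x y where "\<And>i. x i \<in> rist m G (w (r i)) \<and> y i \<in> rist m G (w (r i)) \<and>
    p dvd A.ord (x i \<cdot> y i \<cdot> inverse (x i) \<cdot> inverse (y i))"
    using r(2) unfolding Q_def by metis
  moreover have "\<not> prefix (w (r i)) (w (r j))" if "i \<noteq> j" for i j
    using inc strict_mono_eq[OF r(1)] that by blast
  ultimately show ?thesis
    using p(1) wV
    by - (rule exI[of _ p], rule exI[of _ "\<lambda>i. w (r i)"], rule exI[of _ x], rule exI[of _ y], simp)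
qed

end

section \<open>The family of subgroups\<close>

locale commutator_family = tree_group +
  fixes p :: nat and v :: "nat \<Rightarrow> nat list" and x y :: "nat \<Rightarrow> nat list \<Rightarrow> nat list"
  assumes prime_p: "prime p"
    and incomparable: "i \<noteq> j \<Longrightarrow> \<not> prefix (v i) (v j)"
    and vV: "v i \<in> V"
    and x_rist: "x i \<in> rist m G (v i)"
    and y_rist: "y i \<in> rist m G (v i)"
    and p_dvd: "p dvd A.ord (x i \<cdot> y i \<cdot> inverse (x i) \<cdot> inverse (y i))"
begin

definition z :: "nat \<Rightarrow> nat list \<Rightarrow> nat list" where
  "z i = x i \<cdot> y i \<cdot> inverse (x i) \<cdot> inverse (y i)"

abbreviation zpow :: "nat \<Rightarrow> int \<Rightarrow> nat list \<Rightarrow> nat list" where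
  "zpow i a \<equiv> z i [^]\<^bsub>aut_tree m\<^esub> a"

text \<open>
  For \<open>I = {}\<close> this is the kernel of the map that sends a finite product of powers of the \<open>z\<^sub>j\<close>,
  \<open>j \<in> J\<close>, to the sum of the exponents modulo \<open>p\<close>; the action below the \<open>v\<^sub>i\<close> with \<open>i \<in> I\<close> is left
  free.  Describing an element by its action, and not as a product of generators, allows membership
  to be refuted by looking at one subtree at a time.
\<close>

definition zero_sum_subgroup :: "nat set \<Rightarrow> nat set \<Rightarrow> (nat list \<Rightarrow> nat list) set" where
  "zero_sum_subgroup I J = {g \<in> G.
     (\<forall>u\<in>V. (\<forall>i\<in>I \<union> J. \<not> prefix (v i) u) \<longrightarrow> g u = u) \<and>
     (\<exists>(a :: nat \<Rightarrow> int) n. (\<forall>i. i \<ge> n \<or> i \<notin> J \<longrightarrow> a i = 0) \<and> int p dvd (\<Sum>i<n. a i) \<and>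
        (\<forall>j\<in>J. \<forall>u\<in>subtree m (v j). g u = zpow j (a j) u))}"

lemma disjoint_subtrees: "\<lbrakk>prefix (v i) u; prefix (v j) u\<rbrakk> \<Longrightarrow> i = j"
  using incomparable prefix_same_cases by metis

lemma z_rist: "z i \<in> rist m G (v i)"
  unfolding z_def using rist_subgroup x_rist y_rist
  by (simp add: subgroup.m_closed subgroup.m_inv_closed)

lemma zpow_rist: "zpow i a \<in> rist m G (v i)"
  by (rule A.subgroup_int_pow_closed[OF rist_subgroup z_rist])

lemma zpow_eq_one_imp_dvd: "zpow i a = \<one>\<^bsub>aut_tree m\<^esub> \<Longrightarrow> int p dvd a"
  using A.int_pow_eq_id[OF rist_carrier[OF z_rist[of i]], of a]
    dvd_trans[of "int p" "int (A.ord (z i))" a] p_dvd[of i, folded z_def] by simp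

lemma zpow_in_subtree: "u \<in> subtree m (v i) \<Longrightarrow> zpow i a u \<in> subtree m (v i)"
  using zpow_rist[of i a]
  by (auto simp: subtree_def rist_stays rist_carrier aut_closed)

lemma zpow_add_apply: "u \<in> subtree m (v i) \<Longrightarrow> zpow i (a + b) u = zpow i a (zpow i b u)"
  using rist_carrier[OF z_rist[of i]] by (simp add: A.int_pow_mult mult_apply subtree_def)

lemma zero_sum_subgroupI:
  fixes a :: "nat \<Rightarrow> int"
  assumes "g \<in> G" "\<And>u. \<lbrakk>u \<in> V; \<forall>i\<in>I \<union> J. \<not> prefix (v i) u\<rbrakk> \<Longrightarrow> g u = u"
    and "\<And>i. i \<ge> n \<or> i \<notin> J \<Longrightarrow> a i = 0" "int p dvd (\<Sum>i<n. a i)"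
    and "\<And>j u. \<lbrakk>j \<in> J; u \<in> subtree m (v j)\<rbrakk> \<Longrightarrow> g u = zpow j (a j) u"
  shows "g \<in> zero_sum_subgroup I J"
  unfolding zero_sum_subgroup_def mem_Collect_eq using assms
  by (intro conjI exI[of _ a] exI[of _ n]) auto

text \<open>
  Having the sum condition for every larger bound as well allows a common bound for two elements.
\<close>

lemma zero_sum_subgroupE:
  assumes "g \<in> zero_sum_subgroup I J"
  obtains n a where "g \<in> G"
    "\<forall>u\<in>V. (\<forall>i\<in>I \<union> J. \<not> prefix (v i) u) \<longrightarrow> g u = u"
    "\<forall>i. i \<ge> n \<or> i \<notin> J \<longrightarrow> a i = 0" "\<forall>N\<ge>n. int p dvd (\<Sum>i<N. a i)"
    "\<forall>j\<in>J. \<forall>u\<in>subtree m (v j). g u = zpow j (a j) u"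
proof -
  obtain a :: "nat \<Rightarrow> int" and n where *: "\<forall>i. i \<ge> n \<or> i \<notin> J \<longrightarrow> a i = 0" "int p dvd (\<Sum>i<n. a i)"
    "\<forall>j\<in>J. \<forall>u\<in>subtree m (v j). g u = zpow j (a j) u"
    using assms unfolding zero_sum_subgroup_def by blast
  have sum: "(\<Sum>i<N. a i) = (\<Sum>i<n. a i)" if "n \<le> N" for N
    using that *(1) by (intro sum.mono_neutral_right) auto
  show ?thesis
  proof (rule that[of n a])
    show "g \<in> G" "\<forall>u\<in>V. (\<forall>i\<in>I \<union> J. \<not> prefix (v i) u) \<longrightarrow> g u = u"
      using assms by (simp_all add: zero_sum_subgroup_def)
    show "\<forall>N\<ge>n. int p dvd (\<Sum>i<N. a i)"
    proof (intro allI impI)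
      show "int p dvd (\<Sum>i<N. a i)" if "n \<le> N" for N
        unfolding sum[OF that] by (rule *(2))
    qed
    show "\<forall>i. i \<ge> n \<or> i \<notin> J \<longrightarrow> a i = 0" by (rule *(1))
    show "\<forall>j\<in>J. \<forall>u\<in>subtree m (v j). g u = zpow j (a j) u" by (rule *(3))
  qed
qed

lemma subgroup_zero_sum_subgroup: "subgroup (zero_sum_subgroup I J) (aut_tree m)"
proof (rule A.subgroupI)
  show "zero_sum_subgroup I J \<subseteq> carrier (aut_tree m)"
    by (auto simp: zero_sum_subgroup_def G_carrier)
  have "\<one>\<^bsub>aut_tree m\<^esub> \<in> zero_sum_subgroup I J"
    using subgroup.one_closed[OF G]
    by (auto intro!: zero_sum_subgroupI[where a = "\<lambda>_. 0" and n = 0] simp: one_apply)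
  then show "zero_sum_subgroup I J \<noteq> {}" by blast
next
  fix g assume g: "g \<in> zero_sum_subgroup I J"
  obtain n a where gG: "g \<in> G"
    and ga: "\<forall>u\<in>V. (\<forall>i\<in>I \<union> J. \<not> prefix (v i) u) \<longrightarrow> g u = u"
      "\<forall>i. i \<ge> n \<or> i \<notin> J \<longrightarrow> a i = 0" "\<forall>N\<ge>n. int p dvd (\<Sum>i<N. a i)"
      "\<forall>j\<in>J. \<forall>u\<in>subtree m (v j). g u = zpow j (a j) u"
    using g by (rule zero_sum_subgroupE)
  show "inverse g \<in> zero_sum_subgroup I J"
  proof (rule zero_sum_subgroupI[where a = "\<lambda>i. - a i" and n = n])
    show "inverse g \<in> G" using gG subgroup.m_inv_closed[OF G] by blast
    show "inverse g u = u" if "u \<in> V" "\<forall>i\<in>I \<union> J. \<not> prefix (v i) u" for u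
      using ga(1) that G_carrier[OF gG] by (simp add: inverse_apply_eq_iff)
    show "inverse g u = zpow j (- a j) u" if j: "j \<in> J" "u \<in> subtree m (v j)" for j u
    proof -
      let ?w = "zpow j (- a j) u"
      have "g ?w = zpow j (a j + - a j) u"
        using ga(4)[rule_format, OF j(1) zpow_in_subtree[OF j(2)]]
          zpow_add_apply[OF j(2), of "a j" "- a j"] by simp
      also have "\<dots> = u" using j(2) by (simp add: one_apply subtree_def)
      finally show ?thesis
        using G_carrier[OF gG] j(2) zpow_in_subtree[OF j(2)]
        by (simp add: inverse_apply_eq_iff subtree_def)
    qed
  qed (use ga(2,3) in \<open>auto simp: sum_negf\<close>)
next
  fix g h assume g: "g \<in> zero_sum_subgroup I J" and h: "h \<in> zero_sum_subgroup I J"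
  obtain n a where gG: "g \<in> G"
    and ga: "\<forall>u\<in>V. (\<forall>i\<in>I \<union> J. \<not> prefix (v i) u) \<longrightarrow> g u = u"
      "\<forall>i. i \<ge> n \<or> i \<notin> J \<longrightarrow> a i = 0" "\<forall>N\<ge>n. int p dvd (\<Sum>i<N. a i)"
      "\<forall>j\<in>J. \<forall>u\<in>subtree m (v j). g u = zpow j (a j) u"
    using g by (rule zero_sum_subgroupE)
  obtain l b where hG: "h \<in> G"
    and hb: "\<forall>u\<in>V. (\<forall>i\<in>I \<union> J. \<not> prefix (v i) u) \<longrightarrow> h u = u"
      "\<forall>i. i \<ge> l \<or> i \<notin> J \<longrightarrow> b i = 0" "\<forall>N\<ge>l. int p dvd (\<Sum>i<N. b i)"
      "\<forall>j\<in>J. \<forall>u\<in>subtree m (v j). h u = zpow j (b j) u"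
    using h by (rule zero_sum_subgroupE)
  note C = G_carrier[OF gG] G_carrier[OF hG]
  show "g \<cdot> h \<in> zero_sum_subgroup I J"
  proof (rule zero_sum_subgroupI[where a = "\<lambda>i. a i + b i" and n = "max n l"])
    show "g \<cdot> h \<in> G" using gG hG subgroup.m_closed[OF G] by blast
    show "(g \<cdot> h) u = u" if "u \<in> V" "\<forall>i\<in>I \<union> J. \<not> prefix (v i) u" for u
      using ga(1) hb(1) that C by (simp add: mult_apply)
    show "(g \<cdot> h) u = zpow j (a j + b j) u" if j: "j \<in> J" "u \<in> subtree m (v j)" for j u
      using ga(4)[rule_format, OF j(1) zpow_in_subtree[OF j(2)]]
        hb(4)[rule_format, OF j] zpow_add_apply[OF j(2)] C j(2)
      by (simp add: mult_apply subtree_def)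
  qed (use ga(2,3) hb(2,3) in \<open>auto simp: sum.distrib\<close>)
qed

lemma rist_in_zero_sum_subgroup:
  assumes i: "i \<in> I" "i \<notin> J" and g: "g \<in> rist m G (v i)"
  shows "g \<in> zero_sum_subgroup I J"
proof (rule zero_sum_subgroupI[where a = "\<lambda>_. 0" and n = 0])
  show "g \<in> G" using g by (simp add: rist_def)
  show "g u = u" if "u \<in> V" "\<forall>i\<in>I \<union> J. \<not> prefix (v i) u" for u
    using that i(1) g by (simp add: rist_fix)
  show "g u = zpow j 0 u" if "j \<in> J" "u \<in> subtree m (v j)" for j u
    using that i(2) rist_fix[OF g, of u] disjoint_subtrees[of i u j]
    by (auto simp: subtree_def one_apply)
qed auto

lemma z_quotient_in_zero_sum_subgroup:
  assumes ij: "i \<in> J" "j \<in> J"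
  shows "z i \<cdot> inverse (z j) \<in> zero_sum_subgroup I J"
proof (cases "i = j")
  case True
  then show ?thesis
    using subgroup.one_closed[OF subgroup_zero_sum_subgroup] rist_carrier[OF z_rist] by simp
next
  case False
  define a :: "nat \<Rightarrow> int" where "a k = (if k = i then 1 else 0) - (if k = j then 1 else 0)" for k
  have C: "z k \<in> carrier (aut_tree m)" for k using rist_carrier[OF z_rist] .
  have invz: "inverse (z j) \<in> rist m G (v j)"
    using z_rist subgroup.m_inv_closed[OF rist_subgroup] by blast
  have apply': "(z i \<cdot> inverse (z j)) u = z i (inverse (z j) u)" if "u \<in> V" for u
    using that C by (simp add: mult_apply)
  show ?thesis
  proof (rule zero_sum_subgroupI[where a = a and n = "Suc (max i j)"])
    show "z i \<cdot> inverse (z j) \<in> G"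
      using z_rist invz subgroup.m_closed[OF G] by (auto simp: rist_def)
    show "(z i \<cdot> inverse (z j)) u = u" if "u \<in> V" "\<forall>i\<in>I \<union> J. \<not> prefix (v i) u" for u
      using that ij rist_fix[OF z_rist] rist_fix[OF invz] by (simp add: apply')
    show "a k = 0" if "Suc (max i j) \<le> k \<or> k \<notin> J" for k
      using that ij by (auto simp: a_def)
    show "int p dvd (\<Sum>k<Suc (max i j). a k)"
      by (simp add: a_def sum_subtractf less_Suc_eq_le del: sum.lessThan_Suc)
    show "(z i \<cdot> inverse (z j)) u = zpow k (a k) u" if k: "k \<in> J" "u \<in> subtree m (v k)" for k u
    proof -
      have u: "u \<in> V" "prefix (v k) u" using k(2) by (auto simp: subtree_def)
      have fix_i: "z i u = u" if "k \<noteq> i"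
        using that u disjoint_subtrees[of i u k] rist_fix[OF z_rist[of i]] by blast
      have fix_j: "inverse (z j) u = u" if "k \<noteq> j"
        using that u disjoint_subtrees[of j u k] rist_fix[OF invz] by blast
      consider "k = i" | "k = j" | "k \<noteq> i" "k \<noteq> j" by blast
      then show ?thesis
      proof cases
        case 1
        then show ?thesis using False fix_j u C by (simp add: apply' a_def)
      next
        case 2
        have "prefix (v j) (inverse (z j) u)"
          using rist_stays[OF invz] u 2 by blast
        then have "z i (inverse (z j) u) = inverse (z j) u"
          using False disjoint_subtrees[of i _ j] rist_fix[OF z_rist[of i]]
            aut_closed[OF rist_carrier[OF invz] u(1)] by blast
        then show ?thesis using 2 False u C by (simp add: apply' a_def A.int_pow_neg)
      next
        case 3
        then show ?thesis using fix_i fix_j u by (simp add: apply' a_def one_apply)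
      qed
    qed
  qed
qed

text \<open>
  If \<open>z\<^sub>c\<close> were in the subgroup, then, comparing orders below each \<open>v\<^sub>j\<close>, its exponents would be
  divisible by \<open>p\<close> except that of \<open>z\<^sub>c\<close>, which would be congruent to \<open>1\<close>.
\<close>

lemma z_notin_zero_sum_subgroup:
  assumes c: "c \<in> J"
  shows "z c \<notin> zero_sum_subgroup I J"
proof
  assume "z c \<in> zero_sum_subgroup I J"
  then obtain n a where "z c \<in> G"
    and "\<forall>u\<in>V. (\<forall>i\<in>I \<union> J. \<not> prefix (v i) u) \<longrightarrow> z c u = u"
    and a: "\<forall>i. i \<ge> n \<or> i \<notin> J \<longrightarrow> a i = 0" "\<forall>N\<ge>n. int p dvd (\<Sum>i<N. a i)"
      "\<forall>j\<in>J. \<forall>u\<in>subtree m (v j). z c u = zpow j (a j) u"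
    by (rule zero_sum_subgroupE)
  have C: "z k \<in> carrier (aut_tree m)" for k using rist_carrier[OF z_rist] .
  have dvd: "int p dvd a j" if "j \<noteq> c" for j
  proof (cases "j \<in> J")
    case True
    have "zpow j (a j) = \<one>\<^bsub>aut_tree m\<^esub>"
    proof (rule rist_eqI[OF zpow_rist subgroup.one_closed[OF rist_subgroup]])
      fix u assume u: "u \<in> subtree m (v j)"
      then have "z c u = u"
        using that disjoint_subtrees[of c u j] rist_fix[OF z_rist[of c]] by (auto simp: subtree_def)
      then show "zpow j (a j) u = \<one>\<^bsub>aut_tree m\<^esub> u"
        using a(3)[rule_format, OF True u] u by (simp add: one_apply subtree_def)
    qed
    then show ?thesis by (rule zpow_eq_one_imp_dvd)
  qed (simp add: a(1))
  have "z c = zpow c (a c)"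
    by (rule rist_eqI[OF z_rist zpow_rist a(3)[rule_format, OF c]])
  then have "zpow c (a c - 1) = \<one>\<^bsub>aut_tree m\<^esub>"
    using C[of c] by (simp add: A.int_pow_diff)
  then have c1: "int p dvd a c - 1" by (rule zpow_eq_one_imp_dvd)
  let ?N = "max n (Suc c)"
  have "(\<Sum>i<?N. a i) = a c + (\<Sum>i\<in>{..<?N} - {c}. a i)"
    by (rule sum.remove) auto
  moreover have "int p dvd (\<Sum>i\<in>{..<?N} - {c}. a i)" by (rule dvd_sum) (use dvd in auto)
  ultimately have "int p dvd a c" using a(2)[rule_format, of ?N] by (simp add: dvd_add_left_iff)
  then have "int p dvd a c - (a c - 1)" using c1 by (rule dvd_diff)
  then have "int p dvd 1" by simp
  then show False using prime_p by (simp add: prime_nat_iff)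
qed

lemma x_in_zero_sum_subgroup_iff:
  assumes i: "i \<notin> J"
  shows "x i \<in> zero_sum_subgroup I J \<longleftrightarrow> i \<in> I"
proof
  assume "x i \<in> zero_sum_subgroup I J"
  then have fix_out: "\<And>u. \<lbrakk>u \<in> V; \<forall>i\<in>I \<union> J. \<not> prefix (v i) u\<rbrakk> \<Longrightarrow> x i u = u"
    by (simp add: zero_sum_subgroup_def)
  show "i \<in> I"
  proof (rule ccontr)
    assume "i \<notin> I"
    have "x i = \<one>\<^bsub>aut_tree m\<^esub>"
    proof (rule rist_eqI[OF x_rist subgroup.one_closed[OF rist_subgroup]])
      fix u assume "u \<in> subtree m (v i)"
      then show "x i u = \<one>\<^bsub>aut_tree m\<^esub> u"
        using fix_out[of u] i \<open>i \<notin> I\<close> disjoint_subtrees[of i u] by (auto simp: subtree_def one_apply)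
    qed
    then have "zpow i 1 = \<one>\<^bsub>aut_tree m\<^esub>"
      using rist_carrier[OF y_rist[of i]] by (simp add: z_def)
    then have "int p dvd 1" by (rule zpow_eq_one_imp_dvd)
    then show False using prime_p by (simp add: prime_nat_iff)
  qed
qed (use i x_rist rist_in_zero_sum_subgroup in blast)

lemma not_closedin_profinite_zero_sum_subgroup:
  assumes H: "subgroup H (aut_tree m)" and J: "infinite J"
    and xy: "\<And>j. j \<in> J \<Longrightarrow> x j \<in> H" "\<And>j. j \<in> J \<Longrightarrow> y j \<in> H"
  shows "\<not> closedin (profinite_topology (aut_tree m\<lparr>carrier := H\<rparr>)) (zero_sum_subgroup I J)"
proof -
  interpret H: group "aut_tree m\<lparr>carrier := H\<rparr>" by (rule A.subgroup_imp_group[OF H])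
  have zH: "z j \<in> H" if "j \<in> J" for j
    using xy[OF that] H by (simp add: z_def subgroup.m_closed subgroup.m_inv_closed)
  obtain c where c: "c \<in> J" using J infinite_imp_nonempty by blast
  show ?thesis
  proof (rule H.not_closedin_profinite_if_commutators_congruent[OF J, of x y z])
    show "x i \<otimes>\<^bsub>aut_tree m\<lparr>carrier := H\<rparr>\<^esub> y j = y j \<otimes>\<^bsub>aut_tree m\<lparr>carrier := H\<rparr>\<^esub> x i"
      if "i \<noteq> j" for i j
      using rist_commute_incomparable[OF vV vV incomparable incomparable x_rist y_rist] that by simp
    show "z i = x i \<otimes>\<^bsub>aut_tree m\<lparr>carrier := H\<rparr>\<^esub> y i
        \<otimes>\<^bsub>aut_tree m\<lparr>carrier := H\<rparr>\<^esub> inv\<^bsub>aut_tree m\<lparr>carrier := H\<rparr>\<^esub> x i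
        \<otimes>\<^bsub>aut_tree m\<lparr>carrier := H\<rparr>\<^esub> inv\<^bsub>aut_tree m\<lparr>carrier := H\<rparr>\<^esub> y i" if "i \<in> J" for i
      using A.m_inv_consistent[OF H] xy[OF that] by (simp add: z_def)
    show "z i \<otimes>\<^bsub>aut_tree m\<lparr>carrier := H\<rparr>\<^esub> inv\<^bsub>aut_tree m\<lparr>carrier := H\<rparr>\<^esub> z j \<in> zero_sum_subgroup I J"
      if "i \<in> J" "j \<in> J" for i j
      using A.m_inv_consistent[OF H zH[OF that(2)]] z_quotient_in_zero_sum_subgroup[OF that] by simp
    show "z c \<notin> zero_sum_subgroup I J" by (rule z_notin_zero_sum_subgroup[OF c])
  qed (use c xy in auto)
qed

lemma zero_sum_subgroup_subset: "zero_sum_subgroup I J \<subseteq> G"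
  by (auto simp: zero_sum_subgroup_def)

text \<open>Acting trivially below the \<open>v\<^sub>j\<close> with \<open>j \<in> J\<close> amounts to having zero exponents there.\<close>

lemma zero_sum_subgroup_empty_subset:
  "I \<inter> J = {} \<Longrightarrow> zero_sum_subgroup {} I \<subseteq> zero_sum_subgroup I J"
proof
  fix g assume IJ: "I \<inter> J = {}" and g: "g \<in> zero_sum_subgroup {} I"
  then have out: "\<And>u. \<lbrakk>u \<in> V; \<forall>i\<in>I. \<not> prefix (v i) u\<rbrakk> \<Longrightarrow> g u = u"
    by (simp add: zero_sum_subgroup_def)
  show "g \<in> zero_sum_subgroup I J"
  proof (rule zero_sum_subgroupI[where a = "\<lambda>_. 0" and n = 0])
    show "g \<in> G" using g zero_sum_subgroup_subset by blast
    show "g u = zpow j 0 u" if "j \<in> J" "u \<in> subtree m (v j)" for j u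
    proof -
      have "\<forall>i\<in>I. \<not> prefix (v i) u"
        using that IJ disjoint_subtrees[of _ u j] by (auto simp: subtree_def)
      then show ?thesis using that out[of u] by (simp add: subtree_def one_apply)
    qed
  qed (use out in auto)
qed

lemma zero_sum_subgroup_not_ERF:
  assumes "infinite I" "I \<inter> J = {}"
  shows "\<not> ERF (aut_tree m\<lparr>carrier := zero_sum_subgroup I J\<rparr>)"
proof -
  have "x i \<in> zero_sum_subgroup I J" "y i \<in> zero_sum_subgroup I J" if "i \<in> I" for i
    using that assms(2) rist_in_zero_sum_subgroup x_rist y_rist by blast+
  then have "\<not> closedin (profinite_topology (aut_tree m\<lparr>carrier := zero_sum_subgroup I J\<rparr>))
      (zero_sum_subgroup {} I)"
    by (intro not_closedin_profinite_zero_sum_subgroup[OF subgroup_zero_sum_subgroup assms(1)])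
  moreover have "subgroup (zero_sum_subgroup {} I) (aut_tree m\<lparr>carrier := zero_sum_subgroup I J\<rparr>)"
    using zero_sum_subgroup_empty_subset[OF assms(2)]
    by (rule A.subgroup_incl[OF subgroup_zero_sum_subgroup subgroup_zero_sum_subgroup])
  ultimately show ?thesis by (auto simp: ERF_def)
qed

text \<open>
  The odd indices carry the condition on exponents that makes each subgroup fail to be closed in \<open>G\<close>,
  the multiples of \<open>4\<close> keep it from being ERF, and the remaining indices code a set \<open>S\<close>.
\<close>

lemma continuum_of_subgroups:
  "\<exists>F :: (nat list \<Rightarrow> nat list) set set. F \<approx> (UNIV :: nat set set) \<and>
     (\<forall>H\<in>F. subgroup H (aut_tree m\<lparr>carrier := G\<rparr>) \<and>
        \<not> closedin (profinite_topology (aut_tree m\<lparr>carrier := G\<rparr>)) H \<and>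
        \<not> ERF (aut_tree m\<lparr>carrier := H\<rparr>))"
proof -
  define J :: "nat set" where "J = {i. odd i}"
  define I :: "nat set \<Rightarrow> nat set" where "I S = range (\<lambda>i. 4 * i) \<union> (\<lambda>i. 4 * i + 2) ` S" for S
  have infJ: "infinite J"
  proof -
    have "infinite (range (\<lambda>i::nat. 2 * i + 1))" by (rule range_inj_infinite) (auto simp: inj_on_def)
    then show ?thesis by (rule contrapos_nn) (auto simp: J_def elim: finite_subset[rotated])
  qed
  have infI: "infinite (I S)" for S
  proof -
    have "infinite (range (\<lambda>i::nat. 4 * i))" by (rule range_inj_infinite) (auto simp: inj_on_def)
    then show ?thesis by (simp add: I_def)
  qed
  have disj: "I S \<inter> J = {}" for S by (auto simp: I_def J_def)
  have code: "4 * i + 2 \<in> I S \<longleftrightarrow> i \<in> S" for i S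
  proof -
    have "4 * i + 2 \<noteq> 4 * k" for k by presburger
    then show ?thesis by (auto simp: I_def)
  qed
  have "inj (\<lambda>S. zero_sum_subgroup (I S) J)"
  proof (rule injI)
    fix S T assume eq: "zero_sum_subgroup (I S) J = zero_sum_subgroup (I T) J"
    have "i \<in> S \<longleftrightarrow> i \<in> T" for i
      using x_in_zero_sum_subgroup_iff[of "4 * i + 2" J "I S"]
        x_in_zero_sum_subgroup_iff[of "4 * i + 2" J "I T"] eq code
      by (simp add: J_def)
    then show "S = T" by blast
  qed
  then have "range (\<lambda>S. zero_sum_subgroup (I S) J) \<approx> (UNIV :: nat set set)"
    by (simp add: inj_on_image_eqpoll_self)
  moreover have "x j \<in> G" "y j \<in> G" for j
    using x_rist y_rist by (auto simp: rist_def)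
  ultimately show ?thesis
    using A.subgroup_incl[OF subgroup_zero_sum_subgroup G zero_sum_subgroup_subset]
      not_closedin_profinite_zero_sum_subgroup[OF G infJ]
      zero_sum_subgroup_not_ERF[OF infI disj]
    by (intro exI[of _ "range (\<lambda>S. zero_sum_subgroup (I S) J)"]) blast
qed

end

theorem theorem1:
  fixes m :: "nat \<Rightarrow> nat" and G :: "(nat list \<Rightarrow> nat list) set"
  assumes "\<forall>n\<ge>1. m n \<ge> 2"
    and "finite {p::nat. prime p \<and> (\<exists>n\<ge>1. p dvd m n)}"
    and "subgroup G (aut_tree m)"
    and "weakly_branch m G"
  shows "(\<exists>F :: (nat list \<Rightarrow> nat list) set set.
            F \<approx> (UNIV :: nat set set) \<and>
            (\<forall>H\<in>F. subgroup H (aut_tree m\<lparr>carrier := G\<rparr>) \<and>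
                   \<not> closedin (profinite_topology (aut_tree m\<lparr>carrier := G\<rparr>)) H \<and>
                   \<not> ERF (aut_tree m\<lparr>carrier := H\<rparr>)))
         \<and> \<not> ERF (aut_tree m\<lparr>carrier := G\<rparr>)"
proof -
  interpret tree_group m G by (rule tree_group.intro) (rule assms(3))
  obtain p and v :: "nat \<Rightarrow> nat list" and x y where "prime p"
    "\<forall>i j. i \<noteq> j \<longrightarrow> \<not> prefix (v i) (v j)"
    "\<forall>i. v i \<in> V \<and> x i \<in> rist m G (v i) \<and> y i \<in> rist m G (v i) \<and>
      p dvd A.ord (x i \<cdot> y i \<cdot> inverse (x i) \<cdot> inverse (y i))"
    using exists_incomparable_commutators_ord_dvd[OF assms(1,2,4)] by blast
  then interpret commutator_family m G p v x y
    by unfold_locales auto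
  obtain F :: "(nat list \<Rightarrow> nat list) set set" where F: "F \<approx> (UNIV :: nat set set)"
    "\<forall>H\<in>F. subgroup H (aut_tree m\<lparr>carrier := G\<rparr>) \<and>
       \<not> closedin (profinite_topology (aut_tree m\<lparr>carrier := G\<rparr>)) H \<and>
       \<not> ERF (aut_tree m\<lparr>carrier := H\<rparr>)"
    using continuum_of_subgroups by blast
  have "F \<noteq> {}" using F(1) by (auto simp: eqpoll_def bij_betw_def)
  then have "\<not> ERF (aut_tree m\<lparr>carrier := G\<rparr>)" using F(2) by (auto simp: ERF_def)
  with F show ?thesis by blast
qed

end
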